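(* For an instance of the Capacitated Facility Location Problem with Customer Preferences (CFLCP) with customers $I$, plants $J$, capacities $c_j$, opening costs $f_j$, allocation costs $g_{ij}$ and strict rankings $\prec_i$, consider the model $$\min_{x,y,u}\ \sum_{j\in J} f_j y_j+\sum_{i\in I}\sum_{j\in J} g_{ij}x_{ij}$$ subject to $$\sum_{j\in J}x_{ij}=1\quad \forall i\in I,$$ $$\sum_{i\in I}x_{ij}\le (c_j-1)y_j+u_j\quad \forall j\in J,$$ $$c_ju_j\le \sum_{i\in I}x_{ij}\quad \forall j\in J,$$ $$x_{ij}\le y_j\quad \forall i\in I,\ j\in J,$$ $$y_j\le u_j+\sum_{j'\in J:\, j'\preceq_i j}x_{ij'}\quad \forall i\in I,\ j\in J,$$ $$x_{ij}\in\{0,1\}\quad \forall i\in I,\ j\in J,\qquad u_j,y_j\in\{0,1\}\quad \forall j\in J.$$ The integrality constraints on the $x$-variables can be relaxed in this model: for every instance, the model obtained by replacing $x_{ij}\in\{0,1\}$ with $0\le x_{ij}\le 1$ for all $i\in I$, $j\in J$ (keeping $u_j,y_j\in\{0,1\}$) is feasible if and only if the original model is feasible, and in that case the two models have the same optimal value.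
   Context: An instance of CFLCP consists of a finite set $J$ of potential plants, a finite set $I$ of customers, for each plant $j\in J$ an opening cost $f_j$ and a capacity $c_j$ (a positive integer, the maximum number of customers that can be allocated to $j$), for each pair $(i,j)\in I\times J$ an allocation cost $g_{ij}$, and for each customer $i\in I$ a strict total order $\prec_i$ on $J$, where $j\prec_i j'$ means that $i$ prefers $j$ to $j'$. One writes $j\preceq_i j'$ if $j\prec_i j'$ or $j=j'$. It is assumed that $c_j<|I|$ for at least one $j\in J$. In the model, $y_j=1$ means plant $j$ is open, $x_{ij}=1$ means customer $i$ is allocated to plant $j$, and $u_j=1$ means plant $j$ is full. *)

theory Defs
  imports Complex_Main
begin

text \<open>
  The preference relation is only constrained on the plants:
  \<open>prec i j j'\<close> means that customer \<open>i\<close> strictly prefers plant \<open>j\<close> to plant \<open>j'\<close>.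
  Opening and allocation costs are arbitrary reals and hence do not occur among
  the parameters of the locale.
\<close>

locale cflcp_instance =
  fixes I :: "'i set" and J :: "'j set"
    and c :: "'j \<Rightarrow> nat"
    and prec :: "'i \<Rightarrow> 'j \<Rightarrow> 'j \<Rightarrow> bool"
  assumes finite_customers: "finite I"
    and finite_plants: "finite J"
    and capacity_pos: "\<And>j. j \<in> J \<Longrightarrow> c j > 0"
    and prec_trans: "\<And>i. i \<in> I \<Longrightarrow> transp_on J (prec i)"
    and prec_irrefl: "\<And>i. i \<in> I \<Longrightarrow> irreflp_on J (prec i)"
    and prec_total: "\<And>i. i \<in> I \<Longrightarrow> totalp_on J (prec i)"
    and capacity_less: "\<exists>j\<in>J. c j < card I"

type_synonym ('i, 'j) cflcp_solution = "('i \<Rightarrow> 'j \<Rightarrow> real) \<times> ('j \<Rightarrow> real) \<times> ('j \<Rightarrow> real)"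

definition cflcp_cost ::
  "'i set \<Rightarrow> 'j set \<Rightarrow> ('j \<Rightarrow> real) \<Rightarrow> ('i \<Rightarrow> 'j \<Rightarrow> real) \<Rightarrow> ('i, 'j) cflcp_solution \<Rightarrow> real"
  where
  "cflcp_cost I J f g = (\<lambda>(x, y, u). (\<Sum>j\<in>J. f j * y j) + (\<Sum>i\<in>I. \<Sum>j\<in>J. g i j * x i j))"

definition cflcp_linear_constraints ::
  "'i set \<Rightarrow> 'j set \<Rightarrow> ('j \<Rightarrow> nat) \<Rightarrow> ('i \<Rightarrow> 'j \<Rightarrow> 'j \<Rightarrow> bool) \<Rightarrow>
    ('i \<Rightarrow> 'j \<Rightarrow> real) \<Rightarrow> ('j \<Rightarrow> real) \<Rightarrow> ('j \<Rightarrow> real) \<Rightarrow> bool"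
  where
  "cflcp_linear_constraints I J c prec x y u \<longleftrightarrow>
     (\<forall>i\<in>I. (\<Sum>j\<in>J. x i j) = 1) \<and>
     (\<forall>j\<in>J. (\<Sum>i\<in>I. x i j) \<le> (real (c j) - 1) * y j + u j) \<and>
     (\<forall>j\<in>J. real (c j) * u j \<le> (\<Sum>i\<in>I. x i j)) \<and>
     (\<forall>i\<in>I. \<forall>j\<in>J. x i j \<le> y j) \<and>
     (\<forall>i\<in>I. \<forall>j\<in>J. y j \<le> u j + (\<Sum>j' | j' \<in> J \<and> (prec i j' j \<or> j' = j). x i j'))"

definition cflcp_model ::
  "'i set \<Rightarrow> 'j set \<Rightarrow> ('j \<Rightarrow> nat) \<Rightarrow> ('i \<Rightarrow> 'j \<Rightarrow> 'j \<Rightarrow> bool) \<Rightarrow> ('i, 'j) cflcp_solution set"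
  where
  "cflcp_model I J c prec =
     {(x, y, u). cflcp_linear_constraints I J c prec x y u \<and>
        (\<forall>i\<in>I. \<forall>j\<in>J. x i j \<in> {0, 1}) \<and> (\<forall>j\<in>J. u j \<in> {0, 1} \<and> y j \<in> {0, 1})}"

definition cflcp_relaxed_model ::
  "'i set \<Rightarrow> 'j set \<Rightarrow> ('j \<Rightarrow> nat) \<Rightarrow> ('i \<Rightarrow> 'j \<Rightarrow> 'j \<Rightarrow> bool) \<Rightarrow> ('i, 'j) cflcp_solution set"
  where
  "cflcp_relaxed_model I J c prec =
     {(x, y, u). cflcp_linear_constraints I J c prec x y u \<and>
        (\<forall>i\<in>I. \<forall>j\<in>J. 0 \<le> x i j \<and> x i j \<le> 1) \<and> (\<forall>j\<in>J. u j \<in> {0, 1} \<and> y j \<in> {0, 1})}"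

definition is_optimal_value :: "'s set \<Rightarrow> ('s \<Rightarrow> real) \<Rightarrow> real \<Rightarrow> bool"
  where
  "is_optimal_value S z v \<longleftrightarrow> (\<exists>s. is_arg_min z (\<lambda>s. s \<in> S) s \<and> z s = v)"

end

theory Submission
  imports Defs
begin

text \<open>
  Fix the binary vectors \<open>y\<close> and \<open>u\<close> of a feasible point of the relaxation. What remains is a
  transportation problem in \<open>x\<close>: the preference constraint of an open plant \<open>j\<close> that is not full
  only says that certain \<open>x\<^sub>i\<^sub>j\<close> vanish, and the column sums have integral bounds. An extra row
  holding the slacks \<open>\<lceil>s\<^sub>j\<rceil> - s\<^sub>j\<close> of the column sums \<open>s\<^sub>j\<close> makes all row and column sums integral.
  Then a row or column with one fractional entry has another, so an alternating walk through
  fractional entries can be continued until it closes up. Shifting mass along it, in the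
  direction that does not increase the cost, until an entry reaches 0 or 1, keeps all row and
  column sums and lowers the number of fractional entries.
\<close>

section \<open>Rounding matrices with integral row and column sums\<close>

text \<open>If all other entries were 0 or 1, the fractional entry would be a difference of two
  integers.\<close>

lemma Ints_sum_another_fractional:
  fixes h :: "'a \<Rightarrow> real"
  assumes "finite S" "sum h S \<in> \<int>" "\<And>s. s \<in> S \<Longrightarrow> 0 \<le> h s \<and> h s \<le> 1"
    and "s \<in> S" "h s \<in> {0<..<1}"
  shows "\<exists>s'\<in>S. s' \<noteq> s \<and> h s' \<in> {0<..<1}"
proof (rule ccontr)
  assume "\<not> ?thesis"
  then have "h s' \<in> {0, 1}" if "s' \<in> S - {s}" for s'
    using assms(3)[of s'] that by force
  then have "sum h (S - {s}) \<in> \<int>"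
    by (intro Ints_sum) fastforce
  moreover have "h s = sum h S - sum h (S - {s})"
    using assms by (simp add: sum.remove)
  ultimately have "h s \<in> \<int>" using assms(2) by simp
  then show False using assms(5) by (auto elim!: Ints_cases)
qed

text \<open>Read \<open>E\<close> as the edges of a bipartite graph between rows and columns. No
  edge is the only one at either of its ends, so a walk never gets stuck and, by finiteness, closes
  up. Alternating signs along the closed walk give \<open>d\<close>.\<close>

lemma alternating_circulation:
  fixes E :: "('r \<times> 'c) set"
  assumes fin: "finite R" "finite C" and sub: "E \<subseteq> R \<times> C" and ne: "E \<noteq> {}"
    and col: "\<And>r c. (r, c) \<in> E \<Longrightarrow> \<exists>r'. r' \<noteq> r \<and> (r', c) \<in> E"
    and row: "\<And>r c. (r, c) \<in> E \<Longrightarrow> \<exists>c'. c' \<noteq> c \<and> (r, c') \<in> E"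
  obtains d :: "'r \<Rightarrow> 'c \<Rightarrow> real"
  where "\<And>r c. (r, c) \<notin> E \<Longrightarrow> d r c = 0" "\<exists>r c. d r c \<noteq> 0"
    "\<And>r. (\<Sum>c\<in>C. d r c) = 0" "\<And>c. (\<Sum>r\<in>R. d r c) = 0"
proof -
  \<comment> \<open>Each step of the walk changes the row within the current column, then the column
    within the new row. Only the second edge is recorded in \<open>w\<close>; the first one is
    \<open>(fst (w (Suc n)), snd (w n))\<close>.\<close>
  have "\<exists>w. \<forall>n::nat. w n \<in> E \<and>
    (fst (w (Suc n)) \<noteq> fst (w n) \<and> (fst (w (Suc n)), snd (w n)) \<in> E \<and> snd (w (Suc n)) \<noteq> snd (w n))"
  proof (rule dependent_nat_choice)
    fix p and n :: nat assume "p \<in> E"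
    then obtain r' where r': "r' \<noteq> fst p" "(r', snd p) \<in> E"
      using col[of "fst p" "snd p"] by auto
    then obtain c' where "c' \<noteq> snd p" "(r', c') \<in> E" using row by blast
    then show "\<exists>q. q \<in> E \<and> fst q \<noteq> fst p \<and> (fst q, snd p) \<in> E \<and> snd q \<noteq> snd p"
      using r' by (intro exI[of _ "(r', c')"]) auto
  qed (use ne in auto)
  then obtain w where w: "\<And>n::nat. w n \<in> E" "\<And>n. fst (w (Suc n)) \<noteq> fst (w n)"
    "\<And>n. (fst (w (Suc n)), snd (w n)) \<in> E" "\<And>n. snd (w (Suc n)) \<noteq> snd (w n)"
    by auto
  define p where "p n = fst (w n)" for n
  define q where "q n = snd (w n)" for n
  have pq: "(p n, q n) \<in> E" "p (Suc n) \<noteq> p n" "(p (Suc n), q n) \<in> E" "q (Suc n) \<noteq> q n" for n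
    using w[of n] by (simp_all add: p_def q_def)
  have p_in: "p n \<in> R" and q_in: "q n \<in> C" for n
    using pq(1) sub by auto
  have "\<exists>b. \<exists>a<b. p a = p b"
  proof (rule ccontr)
    assume "\<not> ?thesis"
    then have "inj p" by (metis injI linorder_neqE_nat)
    moreover have "finite (range p)"
      using p_in fin(1) by (meson finite_subset image_subsetI)
    ultimately show False using finite_imageD by blast
  qed
  \<comment> \<open>Taking the first index at which a row repeats makes the rows \<open>p a\<close>,
    ..., \<open>p (b - 1)\<close> pairwise distinct. Columns may still repeat on this
    stretch.\<close>
  define b where "b = (LEAST b. \<exists>a<b. p a = p b)"
  obtain a where a: "a < b" "p a = p b"
    using LeastI_ex[OF \<open>\<exists>b. \<exists>a<b. p a = p b\<close>] unfolding b_def by blast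
  have minimal: "p k \<noteq> p l" if "k < l" "l < b" for k l
    using not_less_Least[of l "\<lambda>b. \<exists>a<b. p a = p b"] that unfolding b_def by blast
  have "Suc a \<noteq> b" using pq(2)[of a] a(2) by metis
  then have Suc_a: "Suc a < b" using a(1) by simp
  \<comment> \<open>The edge leaving \<open>p k\<close> along column \<open>q k\<close> gets weight
    1 and the edge entering \<open>p (Suc k)\<close> along the same column gets weight -1. A sum is
    used because repeated columns could make an edge occur more than once.\<close>
  define d :: "'r \<Rightarrow> 'c \<Rightarrow> real" where
    "d r c = (\<Sum>k\<in>{a..<b}. of_bool (p k = r \<and> q k = c) - of_bool (p (Suc k) = r \<and> q k = c))"
    for r c
  have sum_C: "(\<Sum>c\<in>C. of_bool (P \<and> c' = c)) = (of_bool P :: real)" if "c' \<in> C" for P c'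
    using fin(2) that by (cases P) (simp_all add: of_bool_def)
  have sum_R: "(\<Sum>r\<in>R. of_bool (r' = r \<and> P)) = (of_bool P :: real)" if "r' \<in> R" for P r'
    using fin(1) that by (cases P) (simp_all add: of_bool_def)
  show thesis
  proof (rule that)
    show "d r c = 0" if "(r, c) \<notin> E" for r c
      unfolding d_def using that pq(1,3) by (intro sum.neutral) auto
    \<comment> \<open>The walk meets the row \<open>p (Suc a)\<close> only at index
      \<open>Suc a\<close>. The edge entering it lies in column \<open>q a\<close>, which differs
      from \<open>q (Suc a)\<close>, so nothing cancels the weight 1 of the leaving edge.\<close>
    have "d (p (Suc a)) (q (Suc a)) = (\<Sum>k\<in>{a..<b}. of_bool (k = Suc a))"
      unfolding d_def
    proof (rule sum.cong[OF refl])
      fix k assume k: "k \<in> {a..<b}"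
      have 1: "p k = p (Suc a) \<longleftrightarrow> k = Suc a"
        using minimal k Suc_a by (metis atLeastLessThan_iff linorder_neqE_nat)
      have 2: "p (Suc k) \<noteq> p (Suc a)" if "k \<noteq> a"
      proof (cases "Suc k = b")
        case True
        then show ?thesis using a(2) pq(2)[of a] by metis
      next
        case False
        then show ?thesis using minimal[of "Suc a" "Suc k"] that k by auto
      qed
      show "of_bool (p k = p (Suc a) \<and> q k = q (Suc a)) -
          of_bool (p (Suc k) = p (Suc a) \<and> q k = q (Suc a)) = (of_bool (k = Suc a) :: real)"
        using 1 2 pq(4)[of a] by (cases "k = a") auto
    qed
    also have "\<dots> = 1" using Suc_a by (simp add: of_bool_def)
    finally show "\<exists>r c. d r c \<noteq> 0" by (metis zero_neq_one)
    show "(\<Sum>c\<in>C. d r c) = 0" for r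
    proof -
      \<comment> \<open>Row sums telescope along the walk and vanish because
        \<open>p a = p b\<close>; column sums vanish term by term.\<close>
      have "(\<Sum>c\<in>C. d r c) = (\<Sum>k\<in>{a..<b}. of_bool (p k = r) - of_bool (p (Suc k) = r))"
        unfolding d_def
        by (subst sum.swap) (simp add: sum_subtractf sum_C q_in)
      also have "\<dots> = - (\<Sum>k\<in>{a..<b}. of_bool (p (Suc k) = r) - of_bool (p k = r))"
        by (simp flip: sum_negf)
      also have "\<dots> = - (of_bool (p b = r) - of_bool (p a = r))"
        using a(1) by (subst sum_Suc_diff') auto
      finally show ?thesis using a(2) by simp
    qed
    show "(\<Sum>r\<in>R. d r c) = 0" for c
      unfolding d_def
      by (subst sum.swap) (simp add: sum_subtractf sum_R p_in)
  qed
qed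

text \<open>This is a ratio test: \<open>h s\<close> is the step length at which a moving entry
  reaches 1 (if it grows) or 0 (if it shrinks), and \<open>t\<close> is the smallest of these. The
  minimizer supplies the entry that has become integral.\<close>

lemma unit_interval_move_until_integral:
  fixes x d :: "'a \<Rightarrow> real"
  assumes "finite S" and x: "\<And>s. s \<in> S \<Longrightarrow> x s \<in> {0<..<1}" and "\<exists>s\<in>S. d s \<noteq> 0"
  obtains t where "0 \<le> t" "\<And>s. s \<in> S \<Longrightarrow> 0 \<le> x s + t * d s \<and> x s + t * d s \<le> 1"
    "\<exists>s\<in>S. x s + t * d s \<in> {0, 1}"
proof -
  define T where "T = {s \<in> S. d s \<noteq> 0}"
  define h where "h s = (if d s > 0 then (1 - x s) / d s else x s / (- d s))" for s
  have T: "finite T" "T \<noteq> {}" using assms by (auto simp: T_def)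
  define t where "t = Min (h ` T)"
  have "t \<in> h ` T" unfolding t_def using T by (intro Min_in) auto
  then obtain s where s: "s \<in> T" "t = h s" by blast
  have le: "t \<le> h s" if "s \<in> T" for s
    unfolding t_def using T that by (intro Min_le) auto
  have pos: "0 < h s" if "s \<in> T" for s
    using that x[of s] by (auto simp: T_def h_def intro!: divide_pos_neg divide_neg_neg)
  show thesis
  proof (rule that)
    show t0: "0 \<le> t" using s pos by fastforce
    show "\<exists>s\<in>S. x s + t * d s \<in> {0, 1}"
      using s by (intro bexI[of _ s]) (auto simp: T_def h_def)
    fix s assume s: "s \<in> S"
    consider "d s = 0" | "d s > 0" | "d s < 0" by linarith
    then show "0 \<le> x s + t * d s \<and> x s + t * d s \<le> 1"
    proof cases
      case 2
      then have "t * d s \<le> 1 - x s"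
        using le[of s] s by (simp add: T_def h_def field_simps)
      moreover have "0 \<le> t * d s" using 2 t0 by simp
      ultimately show ?thesis using x[OF s] by auto
    next
      case 3
      then have "t * (- d s) \<le> x s"
        using le[of s] s by (simp add: T_def h_def pos_le_divide_eq del: mult_minus_right divide_minus_right)
      moreover have "0 \<le> t * (- d s)" using 3 t0 by (intro mult_nonneg_nonneg) auto
      ultimately show ?thesis using x[OF s] by auto
    qed (use x[OF s] in auto)
  qed
qed

text \<open>Only fractional entries ever move, hence zeros stay zero. For the location model this
  keeps forbidden allocations forbidden.\<close>

lemma integral_rounding:
  fixes x w :: "'r \<Rightarrow> 'c \<Rightarrow> real"
  assumes fin: "finite R" "finite C"
    and "\<And>r c. r \<in> R \<Longrightarrow> c \<in> C \<Longrightarrow> 0 \<le> x r c \<and> x r c \<le> 1"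
    and "\<And>r. r \<in> R \<Longrightarrow> (\<Sum>c\<in>C. x r c) \<in> \<int>"
    and "\<And>c. c \<in> C \<Longrightarrow> (\<Sum>r\<in>R. x r c) \<in> \<int>"
  shows "\<exists>x'. (\<forall>r\<in>R. \<forall>c\<in>C. x' r c \<in> {0, 1} \<and> (x r c = 0 \<longrightarrow> x' r c = 0)) \<and>
    (\<forall>r\<in>R. (\<Sum>c\<in>C. x' r c) = (\<Sum>c\<in>C. x r c)) \<and>
    (\<forall>c\<in>C. (\<Sum>r\<in>R. x' r c) = (\<Sum>r\<in>R. x r c)) \<and>
    (\<Sum>r\<in>R. \<Sum>c\<in>C. w r c * x' r c) \<le> (\<Sum>r\<in>R. \<Sum>c\<in>C. w r c * x r c)"
  using assms(3-)
proof (induction "card {(r, c) \<in> R \<times> C. x r c \<in> {0<..<1}}" arbitrary: x rule: less_induct)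
  case less
  define E where "E = {(r, c) \<in> R \<times> C. x r c \<in> {0<..<1}}"
  have finE: "finite E"
    by (rule finite_subset[of _ "R \<times> C"]) (auto simp: E_def fin)
  show ?case
  proof (cases "E = {}")
    case True
    then have "x r c \<in> {0, 1}" if "r \<in> R" "c \<in> C" for r c
      using less.prems(1)[OF that] that by (force simp: E_def)
    then show ?thesis by (intro exI[of _ x]) auto
  next
    case False
    obtain d0 where d0: "\<And>r c. (r, c) \<notin> E \<Longrightarrow> d0 r c = 0" "\<exists>r c. d0 r c \<noteq> (0::real)"
      "\<And>r. (\<Sum>c\<in>C. d0 r c) = 0" "\<And>c. (\<Sum>r\<in>R. d0 r c) = 0"
    proof (rule alternating_circulation[OF fin _ False])
      show "E \<subseteq> R \<times> C" by (auto simp: E_def)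
      show "\<exists>r'. r' \<noteq> r \<and> (r', c) \<in> E" if "(r, c) \<in> E" for r c
        using Ints_sum_another_fractional[of R "\<lambda>r. x r c" r] fin less.prems that
        by (auto simp: E_def)
      show "\<exists>c'. c' \<noteq> c \<and> (r, c') \<in> E" if "(r, c) \<in> E" for r c
        using Ints_sum_another_fractional[of C "\<lambda>c. x r c" c] fin less.prems that
        by (auto simp: E_def)
    qed blast
    \<comment> \<open>Both \<open>d0\<close> and its negative are circulations; the sign picks one
      along which the cost does not increase.\<close>
    define e :: real where
      "e = (if (\<Sum>r\<in>R. \<Sum>c\<in>C. w r c * d0 r c) \<le> 0 then 1 else - 1)"
    define d where "d r c = e * d0 r c" for r c
    have e: "e \<noteq> 0" by (simp add: e_def)
    have d: "\<And>r c. (r, c) \<notin> E \<Longrightarrow> d r c = 0" "\<exists>s\<in>E. case_prod d s \<noteq> 0"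
      "\<And>r. (\<Sum>c\<in>C. d r c) = 0" "\<And>c. (\<Sum>r\<in>R. d r c) = 0"
      using d0 e by (force simp: d_def simp flip: sum_distrib_left)+
    have "(\<Sum>r\<in>R. \<Sum>c\<in>C. w r c * d r c) = e * (\<Sum>r\<in>R. \<Sum>c\<in>C. w r c * d0 r c)"
      by (simp add: d_def sum_distrib_left mult.left_commute)
    then have d_cost: "(\<Sum>r\<in>R. \<Sum>c\<in>C. w r c * d r c) \<le> 0"
      by (simp add: e_def)
    obtain t where t: "0 \<le> t"
      "\<And>s. s \<in> E \<Longrightarrow> 0 \<le> case_prod x s + t * case_prod d s \<and> case_prod x s + t * case_prod d s \<le> 1"
      "\<exists>s\<in>E. case_prod x s + t * case_prod d s \<in> {0, 1}"
      by (rule unit_interval_move_until_integral[OF finE _ d(2), of "case_prod x"])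
        (auto simp: E_def)
    define z where "z r c = x r c + t * d r c" for r c
    have z_same: "z r c = x r c" if "(r, c) \<notin> E" for r c
      using d(1)[OF that] by (simp add: z_def)
    have z_row: "(\<Sum>c\<in>C. z r c) = (\<Sum>c\<in>C. x r c)" for r
      by (simp add: z_def sum.distrib d(3) flip: sum_distrib_left)
    have z_col: "(\<Sum>r\<in>R. z r c) = (\<Sum>r\<in>R. x r c)" for c
      by (simp add: z_def sum.distrib d(4) flip: sum_distrib_left)
    have "(\<Sum>r\<in>R. \<Sum>c\<in>C. w r c * z r c) =
        (\<Sum>r\<in>R. \<Sum>c\<in>C. w r c * x r c) + t * (\<Sum>r\<in>R. \<Sum>c\<in>C. w r c * d r c)"
      by (simp add: z_def ring_distribs sum.distrib sum_distrib_left mult.left_commute)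
    then have z_cost: "(\<Sum>r\<in>R. \<Sum>c\<in>C. w r c * z r c) \<le> (\<Sum>r\<in>R. \<Sum>c\<in>C. w r c * x r c)"
      using mult_nonneg_nonpos[OF t(1) d_cost] by simp
    have z_range: "0 \<le> z r c \<and> z r c \<le> 1" if "r \<in> R" "c \<in> C" for r c
      using t(2)[of "(r, c)"] z_same[of r c] less.prems(1)[OF that]
      by (cases "(r, c) \<in> E") (auto simp: z_def)
    \<comment> \<open>Entries outside \<open>E\<close> are unchanged, so no new fractional entry
      arises, and the one that stopped the move has left \<open>E\<close>.\<close>
    have "{(r, c) \<in> R \<times> C. z r c \<in> {0<..<1}} \<subset> E"
    proof
      show "{(r, c) \<in> R \<times> C. z r c \<in> {0<..<1}} \<subseteq> E"
        using z_same by (fastforce simp: E_def)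
      show "{(r, c) \<in> R \<times> C. z r c \<in> {0<..<1}} \<noteq> E"
        using t(3) by (force simp: z_def)
    qed
    then have "card {(r, c) \<in> R \<times> C. z r c \<in> {0<..<1}} < card E"
      by (rule psubset_card_mono[OF finE])
    then obtain x' where x':
      "\<forall>r\<in>R. \<forall>c\<in>C. x' r c \<in> {0, 1} \<and> (z r c = 0 \<longrightarrow> x' r c = 0)"
      "\<forall>r\<in>R. (\<Sum>c\<in>C. x' r c) = (\<Sum>c\<in>C. z r c)"
      "\<forall>c\<in>C. (\<Sum>r\<in>R. x' r c) = (\<Sum>r\<in>R. z r c)"
      "(\<Sum>r\<in>R. \<Sum>c\<in>C. w r c * x' r c) \<le> (\<Sum>r\<in>R. \<Sum>c\<in>C. w r c * z r c)"
      using less.hyps[of z] z_range less.prems(2,3) unfolding E_def z_row z_col by blast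
    have "x r c = 0 \<Longrightarrow> z r c = 0" for r c
      using z_same[of r c] by (auto simp: E_def)
    then show ?thesis
      using x' z_cost by (intro exI[of _ x']) (auto simp: z_row z_col)
  qed
qed

text \<open>A rounded slack is 0 or 1, so a column sum becomes its ceiling or one less. For a
  non-integral sum these are ceiling and floor; for an integral sum the slack is 0 and, as zeros are
  preserved, stays 0.\<close>

lemma integral_rounding_floor_ceiling:
  fixes x w :: "'r \<Rightarrow> 'c \<Rightarrow> real"
  assumes fin: "finite R" "finite C"
    and range: "\<And>r c. r \<in> R \<Longrightarrow> c \<in> C \<Longrightarrow> 0 \<le> x r c \<and> x r c \<le> 1"
    and row: "\<And>r. r \<in> R \<Longrightarrow> (\<Sum>c\<in>C. x r c) \<in> \<int>"
  obtains x' where "\<And>r c. r \<in> R \<Longrightarrow> c \<in> C \<Longrightarrow> x' r c \<in> {0, 1}"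
    "\<And>r c. r \<in> R \<Longrightarrow> c \<in> C \<Longrightarrow> x r c = 0 \<Longrightarrow> x' r c = 0"
    "\<And>r. r \<in> R \<Longrightarrow> (\<Sum>c\<in>C. x' r c) = (\<Sum>c\<in>C. x r c)"
    "\<And>c. c \<in> C \<Longrightarrow> of_int \<lfloor>\<Sum>r\<in>R. x r c\<rfloor> \<le> (\<Sum>r\<in>R. x' r c)"
    "\<And>c. c \<in> C \<Longrightarrow> (\<Sum>r\<in>R. x' r c) \<le> of_int \<lceil>\<Sum>r\<in>R. x r c\<rceil>"
    "(\<Sum>r\<in>R. \<Sum>c\<in>C. w r c * x' r c) \<le> (\<Sum>r\<in>R. \<Sum>c\<in>C. w r c * x r c)"
proof -
  define s where "s c = (\<Sum>r\<in>R. x r c)" for c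
  \<comment> \<open>The index \<open>None\<close> is the slack row, which \<open>W\<close> makes
    free of cost.\<close>
  define X where "X = case_option (\<lambda>c. of_int \<lceil>s c\<rceil> - s c) x"
  define W where "W = case_option (\<lambda>_. 0) w"
  define R' where "R' = insert None (Some ` R)"
  have finR': "finite R'" by (simp add: R'_def fin)
  have sum_R': "(\<Sum>r\<in>R'. h r) = h None + (\<Sum>r\<in>R. h (Some r))" for h :: "'r option \<Rightarrow> real"
    by (simp add: R'_def fin sum.reindex)
  have X_col: "(\<Sum>r\<in>R'. X r c) = of_int \<lceil>s c\<rceil>" for c
    by (simp add: sum_R' X_def s_def)
  have "0 \<le> X r c \<and> X r c \<le> 1" if "r \<in> R'" "c \<in> C" for r c
    using that range ceiling_correct[of "s c"] by (auto simp: R'_def X_def)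
  moreover have "(\<Sum>c\<in>C. X r c) \<in> \<int>" if "r \<in> R'" for r
  proof (cases r)
    case None
    \<comment> \<open>The slack row has an integral sum because the total mass of \<open>x\<close>,
      counted by rows, is an integer.\<close>
    have "(\<Sum>c\<in>C. s c) = (\<Sum>r\<in>R. \<Sum>c\<in>C. x r c)"
      unfolding s_def by (rule sum.swap)
    also have "\<dots> \<in> \<int>" using row by (rule Ints_sum)
    finally show ?thesis by (auto simp: None X_def sum_subtractf)
  qed (use that row in \<open>auto simp: R'_def X_def\<close>)
  moreover have "(\<Sum>r\<in>R'. X r c) \<in> \<int>" for c
    by (simp add: X_col)
  ultimately obtain Y where Y:
    "\<forall>r\<in>R'. \<forall>c\<in>C. Y r c \<in> {0, 1} \<and> (X r c = 0 \<longrightarrow> Y r c = 0)"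
    "\<forall>r\<in>R'. (\<Sum>c\<in>C. Y r c) = (\<Sum>c\<in>C. X r c)"
    "\<forall>c\<in>C. (\<Sum>r\<in>R'. Y r c) = (\<Sum>r\<in>R'. X r c)"
    "(\<Sum>r\<in>R'. \<Sum>c\<in>C. W r c * Y r c) \<le> (\<Sum>r\<in>R'. \<Sum>c\<in>C. W r c * X r c)"
    using integral_rounding[OF finR' fin(2), of X W] by blast
  have col: "(\<Sum>r\<in>R. Y (Some r) c) = of_int \<lceil>s c\<rceil> - Y None c" if "c \<in> C" for c
    using Y(3) that by (simp add: X_col sum_R' algebra_simps)
  have slack: "Y None c \<in> {0, 1}" "s c = of_int \<lceil>s c\<rceil> \<Longrightarrow> Y None c = 0" if "c \<in> C" for c
    using Y(1) that by (auto simp: R'_def X_def)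
  show thesis
  proof (rule that[of "\<lambda>r. Y (Some r)"])
    fix c assume c: "c \<in> C"
    show "of_int \<lfloor>\<Sum>r\<in>R. x r c\<rfloor> \<le> (\<Sum>r\<in>R. Y (Some r) c)"
    proof (cases "s c = of_int \<lceil>s c\<rceil>")
      case True
      then show ?thesis using slack(2)[OF c] col[OF c] of_int_floor_le[of "s c"]
        by (simp flip: s_def)
    next
      case False
      then have "of_int \<lfloor>s c\<rfloor> \<le> of_int \<lceil>s c\<rceil> - (1::real)"
        by (simp add: ceiling_altdef split: if_splits)
      then show ?thesis using slack(1)[OF c] col[OF c] by (auto simp flip: s_def)
    qed
    show "(\<Sum>r\<in>R. Y (Some r) c) \<le> of_int \<lceil>\<Sum>r\<in>R. x r c\<rceil>"
      using slack(1)[OF c] col[OF c] by (auto simp flip: s_def)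
  qed (use Y in \<open>auto simp: R'_def X_def W_def fin sum.reindex\<close>)
qed

section \<open>The facility location models\<close>

lemma cflcp_model_subset_relaxed: "cflcp_model I J c prec \<subseteq> cflcp_relaxed_model I J c prec"
  by (fastforce simp: cflcp_model_def cflcp_relaxed_model_def)

text \<open>Only \<open>x\<close> is rounded; \<open>y\<close> and \<open>u\<close> are kept, so the
  opening costs do not change.\<close>

lemma cflcp_relaxed_model_rounding:
  fixes I :: "'i set" and J :: "'j set"
  assumes fin: "finite I" "finite J" and s: "s \<in> cflcp_relaxed_model I J c prec"
  shows "\<exists>s'\<in>cflcp_model I J c prec. cflcp_cost I J f g s' \<le> cflcp_cost I J f g s"
proof -
  obtain x y u where s_eq: "s = (x, y, u)" by (cases s)
  have lin: "\<And>i. i \<in> I \<Longrightarrow> (\<Sum>j\<in>J. x i j) = 1"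
    "\<And>j. j \<in> J \<Longrightarrow> (\<Sum>i\<in>I. x i j) \<le> (real (c j) - 1) * y j + u j"
    "\<And>j. j \<in> J \<Longrightarrow> real (c j) * u j \<le> (\<Sum>i\<in>I. x i j)"
    "\<And>i j. i \<in> I \<Longrightarrow> j \<in> J \<Longrightarrow> x i j \<le> y j"
    "\<And>i j. i \<in> I \<Longrightarrow> j \<in> J \<Longrightarrow> y j \<le> u j + (\<Sum>j' | j' \<in> J \<and> (prec i j' j \<or> j' = j). x i j')"
    and range: "\<And>i j. i \<in> I \<Longrightarrow> j \<in> J \<Longrightarrow> 0 \<le> x i j \<and> x i j \<le> 1"
    and bin: "\<And>j. j \<in> J \<Longrightarrow> u j \<in> {0, 1}" "\<And>j. j \<in> J \<Longrightarrow> y j \<in> {0, 1}"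
    using s unfolding s_eq cflcp_relaxed_model_def cflcp_linear_constraints_def by auto
  have row: "(\<Sum>j\<in>J. x i j) \<in> \<int>" if "i \<in> I" for i
    using lin(1)[OF that] by simp
  obtain x' where x': "\<And>i j. i \<in> I \<Longrightarrow> j \<in> J \<Longrightarrow> x' i j \<in> {0, 1}"
    "\<And>i j. i \<in> I \<Longrightarrow> j \<in> J \<Longrightarrow> x i j = 0 \<Longrightarrow> x' i j = 0"
    "\<And>i. i \<in> I \<Longrightarrow> (\<Sum>j\<in>J. x' i j) = (\<Sum>j\<in>J. x i j)"
    "\<And>j. j \<in> J \<Longrightarrow> of_int \<lfloor>\<Sum>i\<in>I. x i j\<rfloor> \<le> (\<Sum>i\<in>I. x' i j)"
    "\<And>j. j \<in> J \<Longrightarrow> (\<Sum>i\<in>I. x' i j) \<le> of_int \<lceil>\<Sum>i\<in>I. x i j\<rceil>"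
    "(\<Sum>i\<in>I. \<Sum>j\<in>J. g i j * x' i j) \<le> (\<Sum>i\<in>I. \<Sum>j\<in>J. g i j * x i j)"
    by (rule integral_rounding_floor_ceiling[OF fin range row, where w = g]) blast+
  \<comment> \<open>For binary \<open>y\<close> and \<open>u\<close> both capacity bounds are
    integers, so they hold for the ceiling and the floor of the old column sum as well.\<close>
  have upper: "(\<Sum>i\<in>I. x' i j) \<le> (real (c j) - 1) * y j + u j" if "j \<in> J" for j
  proof -
    have "(real (c j) - 1) * y j + u j \<in> \<int>" using bin[OF that] by auto
    then obtain k where k: "(real (c j) - 1) * y j + u j = of_int k" by (elim Ints_cases)
    then have "\<lceil>\<Sum>i\<in>I. x i j\<rceil> \<le> k" using lin(2)[OF that] by (simp add: ceiling_le_iff)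
    then show ?thesis using x'(5)[OF that] unfolding k
      by (meson of_int_le_iff order_trans)
  qed
  have lower: "real (c j) * u j \<le> (\<Sum>i\<in>I. x' i j)" if "j \<in> J" for j
  proof -
    have "real (c j) * u j \<in> \<int>" using bin[OF that] by auto
    then obtain k where k: "real (c j) * u j = of_int k" by (elim Ints_cases)
    then have "k \<le> \<lfloor>\<Sum>i\<in>I. x i j\<rfloor>" using lin(3)[OF that] by (simp add: le_floor_iff)
    then show ?thesis using x'(4)[OF that] unfolding k
      by (meson of_int_le_iff order_trans)
  qed
  \<comment> \<open>If \<open>y j = 0\<close>, then \<open>x i j = 0\<close>, and this zero survives
    the rounding.\<close>
  have le_y: "x' i j \<le> y j" if "i \<in> I" "j \<in> J" for i j
    using x'(1,2)[OF that] lin(4)[OF that] range[OF that] bin(2)[OF that(2)] by force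
  have pref: "y j \<le> u j + (\<Sum>j' | j' \<in> J \<and> (prec i j' j \<or> j' = j). x' i j')"
    if i: "i \<in> I" and j: "j \<in> J" for i j
  proof -
    define P where "P = {j' \<in> J. prec i j' j \<or> j' = j}"
    have P: "P \<subseteq> J" by (auto simp: P_def)
    have nonneg: "0 \<le> (\<Sum>j'\<in>P. x' i j')"
      using x'(1)[OF i] P by (intro sum_nonneg) force
    show ?thesis
    \<comment> \<open>In this case the constraint forces the whole unit of customer \<open>i\<close>
      into \<open>P\<close>. Thus \<open>x\<close> vanishes outside \<open>P\<close>, so does
      \<open>x'\<close>, and the row sum 1 puts the unit back into \<open>P\<close>. In all other
      cases \<open>y j \<le> u j\<close>.\<close>
    proof (cases "y j = 1 \<and> u j = 0")
      case True
      have split: "(\<Sum>j\<in>J. h j) = (\<Sum>j\<in>J - P. h j) + (\<Sum>j\<in>P. h j)" for h :: "'j \<Rightarrow> real"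
        using P fin(2) by (rule sum.subset_diff)
      have "1 \<le> (\<Sum>j'\<in>P. x i j')" using lin(5)[OF i j] True by (simp add: P_def)
      then have "(\<Sum>j'\<in>J - P. x i j') \<le> 0" using split[of "x i"] lin(1)[OF i] by simp
      moreover have "0 \<le> (\<Sum>j'\<in>J - P. x i j')"
        using range[OF i] by (intro sum_nonneg) auto
      ultimately have "\<forall>j'\<in>J - P. x i j' = 0"
        using range[OF i] fin(2) by (subst sum_nonneg_eq_0_iff[symmetric]) auto
      then have "(\<Sum>j'\<in>J - P. x' i j') = 0" using x'(2)[OF i] by (intro sum.neutral) auto
      then show ?thesis using split[of "x' i"] x'(3)[OF i] lin(1)[OF i] True
        by (simp add: P_def)
    next
      case False
      then show ?thesis using bin[OF j] nonneg by (auto simp: P_def)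
    qed
  qed
  have "(x', y, u) \<in> cflcp_model I J c prec"
    using x'(1,3) lin(1) upper lower le_y pref bin
    unfolding cflcp_model_def cflcp_linear_constraints_def by auto
  moreover have "cflcp_cost I J f g (x', y, u) \<le> cflcp_cost I J f g s"
    using x'(6) by (simp add: cflcp_cost_def s_eq)
  ultimately show ?thesis by blast
qed

text \<open>
  The model itself is infinite in general, because \<open>x\<close>, \<open>y\<close> and \<open>u\<close> are unconstrained outside
  \<open>I\<close> and \<open>J\<close>.
\<close>

lemma finite_cflcp_cost_model:
  assumes "finite I" "finite J"
  shows "finite (cflcp_cost I J f g ` cflcp_model I J c prec)"
proof (rule finite_subset)
  \<comment> \<open>The cost depends only on the set of allocated pairs and the set of open plants,
    and there are finitely many such pairs of sets.\<close>
  let ?F = "\<lambda>(X, Y). (\<Sum>j\<in>J. f j * of_bool (j \<in> Y)) + (\<Sum>i\<in>I. \<Sum>j\<in>J. g i j * of_bool ((i, j) \<in> X))"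
  show "cflcp_cost I J f g ` cflcp_model I J c prec \<subseteq> ?F ` (Pow (I \<times> J) \<times> Pow J)"
  proof (rule image_subsetI)
    fix s assume s: "s \<in> cflcp_model I J c prec"
    obtain x y u where s_eq: "s = (x, y, u)" by (cases s)
    have bin: "\<And>i j. i \<in> I \<Longrightarrow> j \<in> J \<Longrightarrow> x i j \<in> {0, 1}" "\<And>j. j \<in> J \<Longrightarrow> y j \<in> {0, 1}"
      using s by (auto simp: s_eq cflcp_model_def)
    have "cflcp_cost I J f g s = ?F ({(i, j) \<in> I \<times> J. x i j = 1}, {j \<in> J. y j = 1})"
      using bin unfolding s_eq cflcp_cost_def prod.case
      by (intro arg_cong2[of _ _ _ _ "(+)"] sum.cong refl) fastforce+
    then show "cflcp_cost I J f g s \<in> ?F ` (Pow (I \<times> J) \<times> Pow J)"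
      by (rule image_eqI) auto
  qed
qed (use assms in simp)

theorem proposition3:
  fixes I :: "'i set" and J :: "'j set"
    and f :: "'j \<Rightarrow> real" and c :: "'j \<Rightarrow> nat" and g :: "'i \<Rightarrow> 'j \<Rightarrow> real"
    and prec :: "'i \<Rightarrow> 'j \<Rightarrow> 'j \<Rightarrow> bool"
  assumes "cflcp_instance I J c prec"
  shows "(cflcp_relaxed_model I J c prec \<noteq> {} \<longleftrightarrow> cflcp_model I J c prec \<noteq> {}) \<and>
    (cflcp_model I J c prec \<noteq> {} \<longrightarrow>
      (\<exists>v. is_optimal_value (cflcp_model I J c prec) (cflcp_cost I J f g) v \<and>
           is_optimal_value (cflcp_relaxed_model I J c prec) (cflcp_cost I J f g) v))"
proof (intro conjI impI)
  let ?M = "cflcp_model I J c prec" and ?R = "cflcp_relaxed_model I J c prec"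
  let ?z = "cflcp_cost I J f g"
  interpret cflcp_instance I J c prec by fact
  note rounding = cflcp_relaxed_model_rounding[OF finite_customers finite_plants, of _ c prec f g]
  show "?R \<noteq> {} \<longleftrightarrow> ?M \<noteq> {}"
    using rounding cflcp_model_subset_relaxed[of I J c prec] by blast
  assume "?M \<noteq> {}"
  moreover have fin: "finite (?z ` ?M)"
    by (rule finite_cflcp_cost_model[OF finite_customers finite_plants])
  ultimately have "Min (?z ` ?M) \<in> ?z ` ?M" by (intro Min_in) auto
  then obtain s where s: "s \<in> ?M" "?z s = Min (?z ` ?M)" by auto
  have min_M: "?z s \<le> ?z s'" if "s' \<in> ?M" for s'
    using fin that by (simp add: s(2))
  \<comment> \<open>A relaxed point costs at least as much as its rounding, which costs at least as
    much as \<open>s\<close>. So the relaxed optimum is attained too, at the same point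
    \<open>s\<close>.\<close>
  have min_R: "?z s \<le> ?z s'" if "s' \<in> ?R" for s'
    using rounding[OF that] min_M by force
  have "is_arg_min ?z (\<lambda>s. s \<in> ?M) s" "is_arg_min ?z (\<lambda>s. s \<in> ?R) s"
    using s(1) min_M min_R cflcp_model_subset_relaxed[of I J c prec]
    by (auto simp: is_arg_min_linorder)
  then show "\<exists>v. is_optimal_value ?M ?z v \<and> is_optimal_value ?R ?z v"
    unfolding is_optimal_value_def by blast
qed

end
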